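(* Let $\Sigma$ be a finite set and $L\subset\Sigma^{\ast}$ a regular language. Then $L$ has a decomposition of the identity if and only if $A(-)$ is a projective $\mathbb{B}$-semimodule.
   Context: $\mathbb{B}=\{0,1\mid 1+1=1\}$ is the Boolean semiring. A $\mathbb{B}$-semimodule is a commutative monoid $(M,+,0)$ with $a+a=a$ for all $a\in M$; homomorphisms preserve $+$ and $0$. A $\mathbb{B}$-semimodule $P$ is projective if for every surjective homomorphism $M\to N$ the induced map $\mathrm{Hom}(P,M)\to\mathrm{Hom}(P,N)$ is surjective. The tensor product $M\otimes N$ is the $\mathbb{B}$-semimodule universal for maps $M\times N\to K$ that are semimodule homomorphisms in each variable. $\Sigma^{\ast}$ is the set of all words in $\Sigma$ and $\alpha_L:\Sigma^{\ast}\to\mathbb{B}$ is given by $\alpha_L(\omega)=1\Leftrightarrow\omega\in L$. The state space $A(-)$ is the quotient of the free $\mathbb{B}$-semimodule $\mathbb{B}[\Sigma^{\ast}]$ with basis $\Sigma^{\ast}$ by the equivalence relation: $\sum_i\omega_i\sim\sum_j\omega'_j$ iff $\sum_i\alpha_L(\omega_iu)=\sum_j\alpha_L(\omega_j'u)$ for all $u\in\Sigma^{\ast}$. The state space $A(+)$ is the quotient of $\mathbb{B}[\Sigma^{\ast}]$ by: $\sum_i\omega_i\sim\sum_j\omega'_j$ iff $\sum_i\alpha_L(u\omega_i)=\sum_j\alpha_L(u\omega_j')$ for all $u\in\Sigma^{\ast}$. Thus for words $x,y$, the expressions $\alpha_L(xu)$ for $u\in A(+)$ and $\alpha_L(vy)$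 for $v\in A(-)$ are well defined by semilinear extension. A decomposition of the identity for $L$ is an element $\sum_{i=1}^m u_i\otimes v_i\in A(+)\otimes A(-)$ such that $\alpha_L(xy)=\sum_{i=1}^m\alpha_L(xu_i)\,\alpha_L(v_iy)$ for all $x,y\in\Sigma^{\ast}$. (One may equivalently require all $u_i,v_i$ to be images of words in $\Sigma^{\ast}$.) *)

theory Defs
  imports "HOL-Algebra.FiniteProduct"
begin

section \<open>The Boolean semiring\<close>

datatype boolean = B0 | B1

instantiation boolean :: comm_semiring_1
begin

definition zero_boolean :: boolean where "0 = B0"

definition one_boolean :: boolean where "1 = B1"

definition plus_boolean :: "boolean \<Rightarrow> boolean \<Rightarrow> boolean" where
  "a + b = (if a = B0 \<and> b = B0 then B0 else B1)"

definition times_boolean :: "boolean \<Rightarrow> boolean \<Rightarrow> boolean" where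
  "a * b = (if a = B1 \<and> b = B1 then B1 else B0)"

instance
proof
  fix a b c :: boolean
  show "a + b + c = a + (b + c)" "a + b = b + a" "0 + a = a"
    "a * b * c = a * (b * c)" "a * b = b * a" "1 * a = a"
    "(a + b) * c = a * c + b * c" "0 * a = 0" "a * 0 = 0" "(0::boolean) \<noteq> 1"
    by (cases a; cases b; cases c;
        simp add: zero_boolean_def one_boolean_def plus_boolean_def times_boolean_def)+
qed

end

lemma boolean_one_plus_one: "(1::boolean) + 1 = 1"
  by (simp add: one_boolean_def plus_boolean_def)

lemma boolean_add_idem [simp]: "(a::boolean) + a = a"
  by (cases a) (auto simp: plus_boolean_def)

lemma sum_boolean_Un:
  fixes f :: "'a \<Rightarrow> boolean"
  assumes "finite S" "finite T"
  shows "sum f (S \<union> T) = sum f S + sum f T"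
  using assms
proof (induction S rule: finite_induct)
  case empty
  then show ?case by simp
next
  case (insert x S)
  show ?case
  proof (cases "x \<in> T")
    case True
    then have "sum f T = f x + sum f (T - {x})"
      using insert by (simp add: sum.remove)
    then have *: "f x + sum f T = sum f T"
      by (simp flip: add.assoc)
    have "sum f (insert x S \<union> T) = sum f S + sum f T"
      using insert True by (simp add: insert_absorb)
    also have "\<dots> = sum f S + (f x + sum f T)"
      by (simp only: *)
    also have "\<dots> = sum f (insert x S) + sum f T"
      using insert by (simp add: ac_simps)
    finally show ?thesis .
  next
    case False
    then show ?thesis
      using insert by (simp add: add.assoc)
  qed
qed


section \<open>Semimodules over the Boolean semiring\<close>

text \<open>Semimodules are monoids with explicit carrier, in the multiplicative notation of
  HOL-Algebra: the addition of the semimodule is \<open>\<otimes>\<close>, its zero is \<open>\<one>\<close>, and \<open>finprod\<close> is the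
  finite sum.\<close>

locale bsemimodule = comm_monoid M for M (structure) +
  assumes idem: "a \<in> carrier M \<Longrightarrow> a \<otimes> a = a"

text \<open>Homomorphisms are made extensional, so that equality of functions is equality of
  homomorphisms.\<close>

definition bhom :: "'a monoid \<Rightarrow> 'b monoid \<Rightarrow> ('a \<Rightarrow> 'b) set" where
  "bhom M N = {h \<in> hom M N. h \<one>\<^bsub>M\<^esub> = \<one>\<^bsub>N\<^esub> \<and> h \<in> extensional (carrier M)}"

text \<open>HOL cannot quantify over all types inside a formula. The first two arguments are the types
  from which the elements of \<open>M\<close> and \<open>N\<close> are taken; \<open>P\<close> is projective if the property
  holds for all choices of these types.\<close>

definition projective :: "'m itself \<Rightarrow> 'n itself \<Rightarrow> 'p monoid \<Rightarrow> bool" where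
  "projective _ _ P \<longleftrightarrow> bsemimodule P \<and>
    (\<forall>(M :: 'm monoid) (N :: 'n monoid) f.
      bsemimodule M \<and> bsemimodule N \<and> f \<in> bhom M N \<and> f ` carrier M = carrier N \<longrightarrow>
      (\<lambda>g. compose (carrier P) f g) ` bhom P M = bhom P N)"

text \<open>A formal sum with coefficients in the Boolean semiring is determined by its finite support.\<close>

definition free_bsm :: "'a set \<Rightarrow> 'a set monoid" where
  "free_bsm X = \<lparr>carrier = {S. S \<subseteq> X \<and> finite S}, mult = (\<union>), one = {}\<rparr>"

lemma bsemimodule_free_bsm: "bsemimodule (free_bsm X)"
  by unfold_locales (auto simp: free_bsm_def)

definition bsm_congruence :: "'a monoid \<Rightarrow> ('a \<times> 'a) set \<Rightarrow> bool" where
  "bsm_congruence M r \<longleftrightarrow> equiv (carrier M) r \<and>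
    (\<forall>(a, a') \<in> r. \<forall>(b, b') \<in> r. (a \<otimes>\<^bsub>M\<^esub> b, a' \<otimes>\<^bsub>M\<^esub> b') \<in> r)"

definition quot_bsm :: "'a monoid \<Rightarrow> ('a \<times> 'a) set \<Rightarrow> 'a set monoid" where
  "quot_bsm M r =
    \<lparr>carrier = carrier M // r,
     mult = (\<lambda>X Y. \<Union>x\<in>X. \<Union>y\<in>Y. r `` {x \<otimes>\<^bsub>M\<^esub> y}),
     one = r `` {\<one>\<^bsub>M\<^esub>}\<rparr>"

lemma quot_bsm_mult:
  assumes "bsm_congruence M r" "a \<in> carrier M" "b \<in> carrier M"
  shows "r `` {a} \<otimes>\<^bsub>quot_bsm M r\<^esub> r `` {b} = r `` {a \<otimes>\<^bsub>M\<^esub> b}"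
proof -
  have eq: "equiv (carrier M) r" using assms by (simp add: bsm_congruence_def)
  have "r `` {x \<otimes>\<^bsub>M\<^esub> y} = r `` {a \<otimes>\<^bsub>M\<^esub> b}" if "x \<in> r `` {a}" "y \<in> r `` {b}" for x y
  proof -
    have "(a \<otimes>\<^bsub>M\<^esub> b, x \<otimes>\<^bsub>M\<^esub> y) \<in> r"
      using assms(1) that by (fastforce simp: bsm_congruence_def)
    then show ?thesis using equiv_class_eq[OF eq] by metis
  qed
  moreover have "a \<in> r `` {a}" "b \<in> r `` {b}"
    using eq assms equiv_class_self by fastforce+
  ultimately have "(\<Union>x\<in>r `` {a}. \<Union>y\<in>r `` {b}. r `` {x \<otimes>\<^bsub>M\<^esub> y}) = r `` {a \<otimes>\<^bsub>M\<^esub> b}"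
    by blast
  then show ?thesis
    by (simp add: quot_bsm_def)
qed

lemma bsemimodule_quot_bsm:
  assumes "bsemimodule M" "bsm_congruence M r"
  shows "bsemimodule (quot_bsm M r)"
proof -
  interpret M: bsemimodule M by fact
  let ?Q = "quot_bsm M r"
  have c: "carrier ?Q = (\<lambda>a. r `` {a}) ` carrier M"
    by (auto simp: quot_bsm_def quotient_def)
  have o: "\<one>\<^bsub>?Q\<^esub> = r `` {\<one>\<^bsub>M\<^esub>}" by (simp add: quot_bsm_def)
  note m = quot_bsm_mult[OF assms(2)]
  show ?thesis
    by unfold_locales (auto simp: c o m M.m_ac M.idem)
qed


section \<open>Tensor product\<close>

inductive_set tensor_cong ::
  "'a monoid \<Rightarrow> 'b monoid \<Rightarrow> (('a \<times> 'b) set \<times> ('a \<times> 'b) set) set"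
  for M :: "'a monoid" and N :: "'b monoid"
where
  add_left: "\<lbrakk>a \<in> carrier M; a' \<in> carrier M; b \<in> carrier N\<rbrakk>
    \<Longrightarrow> ({(a \<otimes>\<^bsub>M\<^esub> a', b)}, {(a, b), (a', b)}) \<in> tensor_cong M N"
| add_right: "\<lbrakk>a \<in> carrier M; b \<in> carrier N; b' \<in> carrier N\<rbrakk>
    \<Longrightarrow> ({(a, b \<otimes>\<^bsub>N\<^esub> b')}, {(a, b), (a, b')}) \<in> tensor_cong M N"
| zero_left: "b \<in> carrier N \<Longrightarrow> ({(\<one>\<^bsub>M\<^esub>, b)}, {}) \<in> tensor_cong M N"
| zero_right: "a \<in> carrier M \<Longrightarrow> ({(a, \<one>\<^bsub>N\<^esub>)}, {}) \<in> tensor_cong M N"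
| refl: "S \<in> carrier (free_bsm (carrier M \<times> carrier N)) \<Longrightarrow> (S, S) \<in> tensor_cong M N"
| sym: "(S, T) \<in> tensor_cong M N \<Longrightarrow> (T, S) \<in> tensor_cong M N"
| trans: "\<lbrakk>(S, T) \<in> tensor_cong M N; (T, U) \<in> tensor_cong M N\<rbrakk> \<Longrightarrow> (S, U) \<in> tensor_cong M N"
| union: "\<lbrakk>(S, S') \<in> tensor_cong M N; (T, T') \<in> tensor_cong M N\<rbrakk>
    \<Longrightarrow> (S \<union> T, S' \<union> T') \<in> tensor_cong M N"

definition tensor :: "'a monoid \<Rightarrow> 'b monoid \<Rightarrow> ('a \<times> 'b) set set monoid" where
  "tensor M N = quot_bsm (free_bsm (carrier M \<times> carrier N)) (tensor_cong M N)"

definition pure_tensor :: "'a monoid \<Rightarrow> 'b monoid \<Rightarrow> 'a \<Rightarrow> 'b \<Rightarrow> ('a \<times> 'b) set set" where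
  "pure_tensor M N a b = tensor_cong M N `` {{(a, b)}}"

definition bilinear_map :: "'a monoid \<Rightarrow> 'b monoid \<Rightarrow> 'k monoid \<Rightarrow> ('a \<Rightarrow> 'b \<Rightarrow> 'k) \<Rightarrow> bool" where
  "bilinear_map M N K \<phi> \<longleftrightarrow>
    (\<forall>b\<in>carrier N. restrict (\<lambda>a. \<phi> a b) (carrier M) \<in> bhom M K) \<and>
    (\<forall>a\<in>carrier M. restrict (\<lambda>b. \<phi> a b) (carrier N) \<in> bhom N K)"

lemma tensor_cong_carrier:
  assumes "bsemimodule M" "bsemimodule N" "(S, T) \<in> tensor_cong M N"
  shows "S \<in> carrier (free_bsm (carrier M \<times> carrier N)) \<and>
    T \<in> carrier (free_bsm (carrier M \<times> carrier N))"
proof -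
  interpret M: bsemimodule M by fact
  interpret N: bsemimodule N by fact
  show ?thesis
    using assms(3) by induction (auto simp: free_bsm_def)
qed

lemma bsm_congruence_tensor_cong:
  assumes "bsemimodule M" "bsemimodule N"
  shows "bsm_congruence (free_bsm (carrier M \<times> carrier N)) (tensor_cong M N)"
proof -
  let ?F = "free_bsm (carrier M \<times> carrier N)"
  have "equiv (carrier ?F) (tensor_cong M N)"
  proof (rule equivI)
    show "tensor_cong M N \<subseteq> carrier ?F \<times> carrier ?F"
      using tensor_cong_carrier[OF assms] by auto
    show "refl_on (carrier ?F) (tensor_cong M N)"
      by (auto simp: refl_on_def intro: tensor_cong.refl)
    show "Relation.sym (tensor_cong M N)"
      by (auto intro: symI tensor_cong.sym)
    show "Relation.trans (tensor_cong M N)"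
      by (auto intro: transI tensor_cong.trans)
  qed
  then show ?thesis
    by (auto simp: bsm_congruence_def free_bsm_def intro: tensor_cong.union)
qed

lemma bsemimodule_tensor:
  assumes "bsemimodule M" "bsemimodule N"
  shows "bsemimodule (tensor M N)"
  unfolding tensor_def
  by (intro bsemimodule_quot_bsm bsemimodule_free_bsm bsm_congruence_tensor_cong assms)

lemma (in bsemimodule) finprod_Un_idem:
  assumes "finite S" "finite T" "f \<in> S \<union> T \<rightarrow> carrier M"
  shows "finprod M f (S \<union> T) = finprod M f S \<otimes> finprod M f T"
  using assms
proof (induction S rule: finite_induct)
  case empty
  then show ?case by simp
next
  case (insert x S)
  have fx: "f x \<in> carrier M" and S: "f \<in> S \<rightarrow> carrier M" and T: "f \<in> T \<rightarrow> carrier M"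
    and ST: "f \<in> S \<union> T \<rightarrow> carrier M"
    using insert by auto
  have cS: "finprod M f S \<in> carrier M" "finprod M f T \<in> carrier M"
    using S T by auto
  have IH: "finprod M f (S \<union> T) = finprod M f S \<otimes> finprod M f T"
    using insert ST by auto
  show ?case
  proof (cases "x \<in> T")
    case True
    have "finprod M f (insert x (T - {x})) = f x \<otimes> finprod M f (T - {x})"
      by (rule finprod_insert) (use insert fx T in auto)
    then have "finprod M f T = f x \<otimes> finprod M f (T - {x})"
      using True by (simp add: insert_absorb)
    moreover have "finprod M f (T - {x}) \<in> carrier M"
      using T by (intro finprod_closed) auto
    ultimately have *: "f x \<otimes> finprod M f T = finprod M f T"
      using fx by (simp add: idem flip: m_assoc)
    have "finprod M f (insert x S \<union> T) = finprod M f S \<otimes> finprod M f T"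
      using True IH by (simp add: insert_absorb)
    also have "\<dots> = finprod M f S \<otimes> (f x \<otimes> finprod M f T)"
      by (simp only: *)
    also have "\<dots> = f x \<otimes> finprod M f S \<otimes> finprod M f T"
      using fx cS by (simp add: m_ac)
    also have "\<dots> = finprod M f (insert x S) \<otimes> finprod M f T"
      using insert fx S by simp
    finally show ?thesis .
  next
    case False
    then show ?thesis
      using insert IH S ST fx cS by (simp add: m_assoc)
  qed
qed

text \<open>The universal property of the tensor product.\<close>

lemma bilinear_map_pure_tensor:
  assumes "bsemimodule M" "bsemimodule N"
  shows "bilinear_map M N (tensor M N) (pure_tensor M N)"
proof -
  interpret M: bsemimodule M by fact
  interpret N: bsemimodule N by fact
  let ?F = "free_bsm (carrier M \<times> carrier N)"
  note cong = bsm_congruence_tensor_cong[OF assms]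
  have eq: "equiv (carrier ?F) (tensor_cong M N)"
    using cong by (simp add: bsm_congruence_def)
  have cl: "pure_tensor M N a b \<in> carrier (tensor M N)"
    if "a \<in> carrier M" "b \<in> carrier N" for a b
    using that by (auto simp: pure_tensor_def tensor_def quot_bsm_def free_bsm_def quotientI)
  have mult: "pure_tensor M N a b \<otimes>\<^bsub>tensor M N\<^esub> pure_tensor M N a' b' =
      tensor_cong M N `` {{(a, b), (a', b')}}"
    if "a \<in> carrier M" "b \<in> carrier N" "a' \<in> carrier M" "b' \<in> carrier N" for a b a' b'
  proof -
    have "{(a, b)} \<otimes>\<^bsub>?F\<^esub> {(a', b')} = {(a, b), (a', b')}"
      by (auto simp: free_bsm_def)
    moreover have "{(a, b)} \<in> carrier ?F" "{(a', b')} \<in> carrier ?F"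
      using that by (auto simp: free_bsm_def)
    ultimately show ?thesis
      using quot_bsm_mult[OF cong, of "{(a, b)}" "{(a', b')}"]
      by (simp only: pure_tensor_def tensor_def)
  qed
  have one: "\<one>\<^bsub>tensor M N\<^esub> = tensor_cong M N `` {{}}"
    by (simp add: tensor_def quot_bsm_def free_bsm_def)
  have al: "pure_tensor M N (a \<otimes>\<^bsub>M\<^esub> a') b =
      pure_tensor M N a b \<otimes>\<^bsub>tensor M N\<^esub> pure_tensor M N a' b"
    if "a \<in> carrier M" "a' \<in> carrier M" "b \<in> carrier N" for a a' b
    unfolding mult[OF that(1,3,2,3)] unfolding pure_tensor_def
    by (rule equiv_class_eq[OF eq tensor_cong.add_left[OF that]])
  have ar: "pure_tensor M N a (b \<otimes>\<^bsub>N\<^esub> b') =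
      pure_tensor M N a b \<otimes>\<^bsub>tensor M N\<^esub> pure_tensor M N a b'"
    if "a \<in> carrier M" "b \<in> carrier N" "b' \<in> carrier N" for a b b'
    unfolding mult[OF that(1,2,1,3)] unfolding pure_tensor_def
    by (rule equiv_class_eq[OF eq tensor_cong.add_right[OF that]])
  have zl: "pure_tensor M N \<one>\<^bsub>M\<^esub> b = \<one>\<^bsub>tensor M N\<^esub>" if "b \<in> carrier N" for b
    unfolding one pure_tensor_def
    by (rule equiv_class_eq[OF eq tensor_cong.zero_left[OF that]])
  have zr: "pure_tensor M N a \<one>\<^bsub>N\<^esub> = \<one>\<^bsub>tensor M N\<^esub>" if "a \<in> carrier M" for a
    unfolding one pure_tensor_def
    by (rule equiv_class_eq[OF eq tensor_cong.zero_right[OF that]])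
  show ?thesis
    by (simp add: bilinear_map_def bhom_def hom_def cl al ar zl zr)
qed

lemma tensor_eq_finprod_pure_tensor:
  assumes "bsemimodule M" "bsemimodule N" "S \<subseteq> carrier M \<times> carrier N" "finite S"
  shows "tensor_cong M N `` {S} = finprod (tensor M N) (\<lambda>(a, b). pure_tensor M N a b) S"
proof -
  interpret M: bsemimodule M by fact
  interpret N: bsemimodule N by fact
  interpret T: bsemimodule "tensor M N" by (rule bsemimodule_tensor) fact+
  note cong = bsm_congruence_tensor_cong[OF assms(1,2)]
  have cl: "pure_tensor M N a b \<in> carrier (tensor M N)"
    if "a \<in> carrier M" "b \<in> carrier N" for a b
    using that by (auto simp: pure_tensor_def tensor_def quot_bsm_def free_bsm_def quotientI)
  show ?thesis
    using assms(4,3)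
  proof (induction S rule: finite_induct)
    case empty
    have "tensor_cong M N `` {{}} = \<one>\<^bsub>tensor M N\<^esub>"
      by (simp add: tensor_def quot_bsm_def free_bsm_def)
    then show ?case by simp
  next
    case (insert p S)
    obtain a b where p: "p = (a, b)" by force
    have "tensor_cong M N `` {{p} \<union> S} =
        tensor_cong M N `` {{p}} \<otimes>\<^bsub>tensor M N\<^esub> tensor_cong M N `` {S}"
      using quot_bsm_mult[OF cong, of "{p}" S] insert
      by (simp add: tensor_def free_bsm_def)
    moreover have "(\<lambda>(a, b). pure_tensor M N a b) \<in> S \<rightarrow> carrier (tensor M N)"
      "(\<lambda>(a, b). pure_tensor M N a b) p \<in> carrier (tensor M N)"
      using insert by (auto intro!: cl)
    ultimately have "finprod (tensor M N) (\<lambda>(a, b). pure_tensor M N a b) (insert p S) =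
        pure_tensor M N a b \<otimes>\<^bsub>tensor M N\<^esub> tensor_cong M N `` {S}"
      using insert by (subst T.finprod_insert) (auto simp: p)
    also have "\<dots> = tensor_cong M N `` {insert p S}"
      using \<open>tensor_cong M N `` {{p} \<union> S} = _\<close> by (simp add: p pure_tensor_def)
    finally show ?case by (rule HOL.sym)
  qed
qed

lemma bhom_finprod:
  assumes "bsemimodule M" "bsemimodule K" "h \<in> bhom M K" "finite S" "f \<in> S \<rightarrow> carrier M"
  shows "h (finprod M f S) = finprod K (\<lambda>x. h (f x)) S"
proof -
  interpret M: bsemimodule M by fact
  interpret K: bsemimodule K by fact
  have h: "h \<in> carrier M \<rightarrow> carrier K"
    and hm: "\<And>x y. x \<in> carrier M \<Longrightarrow> y \<in> carrier M \<Longrightarrow> h (x \<otimes>\<^bsub>M\<^esub> y) = h x \<otimes>\<^bsub>K\<^esub> h y"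
    and h1: "h \<one>\<^bsub>M\<^esub> = \<one>\<^bsub>K\<^esub>"
    using assms(3) by (auto simp: bhom_def hom_def)
  show ?thesis
    using assms(4,5)
  proof (induction S rule: finite_induct)
    case empty
    then show ?case by (simp add: h1)
  next
    case (insert x S)
    then have "f x \<in> carrier M" "f \<in> S \<rightarrow> carrier M" "(\<lambda>x. h (f x)) \<in> S \<rightarrow> carrier K"
      "h (f x) \<in> carrier K"
      using h by auto
    then show ?case using insert by (simp add: hm)
  qed
qed

theorem tensor_universal:
  assumes "bsemimodule M" "bsemimodule N" "bsemimodule K" "bilinear_map M N K \<phi>"
  shows "\<exists>!h. h \<in> bhom (tensor M N) K \<and>
    (\<forall>a\<in>carrier M. \<forall>b\<in>carrier N. h (pure_tensor M N a b) = \<phi> a b)"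
proof -
  interpret M: bsemimodule M by fact
  interpret N: bsemimodule N by fact
  interpret K: bsemimodule K by fact
  interpret T: bsemimodule "tensor M N" by (rule bsemimodule_tensor) fact+
  let ?F = "free_bsm (carrier M \<times> carrier N)"
  note cong = bsm_congruence_tensor_cong[OF assms(1,2)]
  have eq: "equiv (carrier ?F) (tensor_cong M N)"
    using cong by (simp add: bsm_congruence_def)
  have carr: "carrier (tensor M N) = (\<lambda>S. tensor_cong M N `` {S}) ` carrier ?F"
    by (auto simp: tensor_def quot_bsm_def quotient_def)
  have one: "\<one>\<^bsub>tensor M N\<^esub> = tensor_cong M N `` {{}}"
    by (simp add: tensor_def quot_bsm_def free_bsm_def)
  define \<psi> where "\<psi> = (\<lambda>(a, b). \<phi> a b)"
  have l: "restrict (\<lambda>a. \<phi> a b) (carrier M) \<in> bhom M K" if "b \<in> carrier N" for b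
    using assms(4) that by (auto simp: bilinear_map_def)
  have r: "restrict (\<lambda>b. \<phi> a b) (carrier N) \<in> bhom N K" if "a \<in> carrier M" for a
    using assms(4) that by (auto simp: bilinear_map_def)
  have cl: "\<phi> a b \<in> carrier K" if "a \<in> carrier M" "b \<in> carrier N" for a b
    using l[OF that(2)] that by (auto simp: bhom_def hom_def Pi_def)
  have al: "\<phi> (a \<otimes>\<^bsub>M\<^esub> a') b = \<phi> a b \<otimes>\<^bsub>K\<^esub> \<phi> a' b"
    if "a \<in> carrier M" "a' \<in> carrier M" "b \<in> carrier N" for a a' b
    using l[OF that(3)] that by (auto simp: bhom_def hom_def)
  have ar: "\<phi> a (b \<otimes>\<^bsub>N\<^esub> b') = \<phi> a b \<otimes>\<^bsub>K\<^esub> \<phi> a b'"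
    if "a \<in> carrier M" "b \<in> carrier N" "b' \<in> carrier N" for a b b'
    using r[OF that(1)] that by (auto simp: bhom_def hom_def)
  have zl: "\<phi> \<one>\<^bsub>M\<^esub> b = \<one>\<^bsub>K\<^esub>" if "b \<in> carrier N" for b
    using l[OF that] by (auto simp: bhom_def)
  have zr: "\<phi> a \<one>\<^bsub>N\<^esub> = \<one>\<^bsub>K\<^esub>" if "a \<in> carrier M" for a
    using r[OF that] by (auto simp: bhom_def)
  have single: "finprod K \<psi> {(a, b)} = \<phi> a b" if "a \<in> carrier M" "b \<in> carrier N" for a b
    using cl[OF that] by (simp add: \<psi>_def)
  have fc: "finprod K \<psi> S \<in> carrier K" if "S \<in> carrier ?F" for S
    using that by (intro K.finprod_closed) (auto simp: free_bsm_def \<psi>_def intro!: cl)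
  have un: "finprod K \<psi> (S \<union> T) = finprod K \<psi> S \<otimes>\<^bsub>K\<^esub> finprod K \<psi> T"
    if "S \<in> carrier ?F" "T \<in> carrier ?F" for S T
    using that by (intro K.finprod_Un_idem) (auto simp: free_bsm_def \<psi>_def intro!: cl)
  have double: "finprod K \<psi> {(a, b), (a', b')} = \<phi> a b \<otimes>\<^bsub>K\<^esub> \<phi> a' b'"
    if "a \<in> carrier M" "b \<in> carrier N" "a' \<in> carrier M" "b' \<in> carrier N" for a b a' b'
  proof -
    have "{(a, b)} \<in> carrier ?F" "{(a', b')} \<in> carrier ?F"
      using that by (auto simp: free_bsm_def)
    then have "finprod K \<psi> ({(a, b)} \<union> {(a', b')}) = \<phi> a b \<otimes>\<^bsub>K\<^esub> \<phi> a' b'"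
      using that by (simp only: un single)
    moreover have "{(a, b)} \<union> {(a', b')} = {(a, b), (a', b')}" by auto
    ultimately show ?thesis by simp
  qed
  have inv: "finprod K \<psi> S = finprod K \<psi> T" if "(S, T) \<in> tensor_cong M N" for S T
    using that
  proof induction
    case (union S S' T T')
    have "finprod K \<psi> (S \<union> T) = finprod K \<psi> S \<otimes>\<^bsub>K\<^esub> finprod K \<psi> T"
      using union.hyps tensor_cong_carrier[OF assms(1,2)] by (intro un) blast+
    also have "\<dots> = finprod K \<psi> S' \<otimes>\<^bsub>K\<^esub> finprod K \<psi> T'"
      by (simp only: union.IH)
    also have "\<dots> = finprod K \<psi> (S' \<union> T')"
      using union.hyps tensor_cong_carrier[OF assms(1,2)] by (intro un[symmetric]) blast+
    finally show ?case .
  qed (simp_all add: single double al ar zl zr)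
  define h where "h = restrict (\<lambda>X. finprod K \<psi> (SOME S. S \<in> X)) (carrier (tensor M N))"
  have h: "h (tensor_cong M N `` {S}) = finprod K \<psi> S" if "S \<in> carrier ?F" for S
  proof -
    have "S \<in> tensor_cong M N `` {S}"
      using that eq equiv_class_self by fastforce
    then have "(SOME T. T \<in> tensor_cong M N `` {S}) \<in> tensor_cong M N `` {S}"
      by (rule someI)
    then have "finprod K \<psi> (SOME T. T \<in> tensor_cong M N `` {S}) = finprod K \<psi> S"
      using inv by (metis Image_singleton_iff)
    then show ?thesis
      using that by (auto simp: h_def carr)
  qed
  have hh: "h \<in> bhom (tensor M N) K"
  proof -
    have "h (x \<otimes>\<^bsub>tensor M N\<^esub> y) = h x \<otimes>\<^bsub>K\<^esub> h y"
      if xy: "x \<in> carrier (tensor M N)" "y \<in> carrier (tensor M N)" for x y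
    proof -
      obtain S T where ST: "S \<in> carrier ?F" "T \<in> carrier ?F"
        "x = tensor_cong M N `` {S}" "y = tensor_cong M N `` {T}"
        using xy by (auto simp: carr)
      have U: "S \<union> T \<in> carrier ?F" using ST(1,2) by (auto simp: free_bsm_def)
      have m: "S \<otimes>\<^bsub>?F\<^esub> T = S \<union> T" by (simp add: free_bsm_def)
      have "x \<otimes>\<^bsub>tensor M N\<^esub> y = tensor_cong M N `` {S \<union> T}"
        using quot_bsm_mult[OF cong ST(1,2)] unfolding ST(3,4) m tensor_def .
      then show ?thesis
        by (simp only: ST(3,4) h[OF U] h[OF ST(1)] h[OF ST(2)] un[OF ST(1,2)])
    qed
    moreover have "h \<in> carrier (tensor M N) \<rightarrow> carrier K"
      by (auto simp: carr h fc)
    moreover have "h \<one>\<^bsub>tensor M N\<^esub> = \<one>\<^bsub>K\<^esub>"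
      unfolding one by (subst h) (auto simp: free_bsm_def)
    moreover have "h \<in> extensional (carrier (tensor M N))"
      by (simp add: h_def)
    ultimately show ?thesis
      by (simp add: bhom_def hom_def)
  qed
  have hp: "h (pure_tensor M N a b) = \<phi> a b" if "a \<in> carrier M" "b \<in> carrier N" for a b
    unfolding pure_tensor_def
    by (subst h) (use that in \<open>auto simp: free_bsm_def single\<close>)
  have uniq: "g = h" if g: "g \<in> bhom (tensor M N) K"
    "\<forall>a\<in>carrier M. \<forall>b\<in>carrier N. g (pure_tensor M N a b) = \<phi> a b" for g
  proof (rule extensionalityI)
    show "g \<in> extensional (carrier (tensor M N))" "h \<in> extensional (carrier (tensor M N))"
      using g hh by (auto simp: bhom_def)
    fix x assume "x \<in> carrier (tensor M N)"
    then obtain S where S: "S \<in> carrier ?F" "x = tensor_cong M N `` {S}"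
      by (auto simp: carr)
    then have S': "S \<subseteq> carrier M \<times> carrier N" "finite S" by (auto simp: free_bsm_def)
    let ?p = "\<lambda>(a, b). pure_tensor M N a b"
    have p: "?p \<in> S \<rightarrow> carrier (tensor M N)"
      using S' by (auto simp: pure_tensor_def carr free_bsm_def)
    have "g x = finprod K (\<lambda>x. g (?p x)) S"
      unfolding S(2) tensor_eq_finprod_pure_tensor[OF assms(1,2) S']
      by (rule bhom_finprod) (use g p S' T.bsemimodule_axioms assms in auto)
    also have "\<dots> = finprod K \<psi> S"
      by (rule K.finprod_cong') (use S' g in \<open>auto simp: \<psi>_def intro!: cl\<close>)
    also have "\<dots> = h x"
      using S h by simp
    finally show "g x = h x" .
  qed
  show ?thesis
  proof (rule ex1I)
    show "h \<in> bhom (tensor M N) K \<and>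
        (\<forall>a\<in>carrier M. \<forall>b\<in>carrier N. h (pure_tensor M N a b) = \<phi> a b)"
      using hh hp by simp
    fix g
    assume "g \<in> bhom (tensor M N) K \<and>
        (\<forall>a\<in>carrier M. \<forall>b\<in>carrier N. g (pure_tensor M N a b) = \<phi> a b)"
    then show "g = h" by (intro uniq) simp_all
  qed
qed


section \<open>Languages and their state spaces\<close>

text \<open>Acceptance by a finite deterministic automaton. Taking the states to be natural numbers is no
  restriction, since automata may be renamed.\<close>

definition regular_language :: "'a set \<Rightarrow> 'a list set \<Rightarrow> bool" where
  "regular_language \<Sigma> L \<longleftrightarrow>
    (\<exists>(Q :: nat set) q0 \<delta> F. finite Q \<and> q0 \<in> Q \<and> F \<subseteq> Q \<and>
      (\<forall>q\<in>Q. \<forall>a\<in>\<Sigma>. \<delta> q a \<in> Q) \<and>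
      L = {\<omega> \<in> lists \<Sigma>. foldl \<delta> q0 \<omega> \<in> F})"

definition alpha :: "'a list set \<Rightarrow> 'a list \<Rightarrow> boolean" where
  "alpha L \<omega> = (if \<omega> \<in> L then 1 else 0)"

definition rel_minus :: "'a set \<Rightarrow> 'a list set \<Rightarrow> ('a list set \<times> 'a list set) set" where
  "rel_minus \<Sigma> L = {(S, T). S \<in> carrier (free_bsm (lists \<Sigma>)) \<and> T \<in> carrier (free_bsm (lists \<Sigma>)) \<and>
    (\<forall>u\<in>lists \<Sigma>. (\<Sum>\<omega>\<in>S. alpha L (\<omega> @ u)) = (\<Sum>\<omega>\<in>T. alpha L (\<omega> @ u)))}"

definition rel_plus :: "'a set \<Rightarrow> 'a list set \<Rightarrow> ('a list set \<times> 'a list set) set" where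
  "rel_plus \<Sigma> L = {(S, T). S \<in> carrier (free_bsm (lists \<Sigma>)) \<and> T \<in> carrier (free_bsm (lists \<Sigma>)) \<and>
    (\<forall>u\<in>lists \<Sigma>. (\<Sum>\<omega>\<in>S. alpha L (u @ \<omega>)) = (\<Sum>\<omega>\<in>T. alpha L (u @ \<omega>)))}"

definition A_minus :: "'a set \<Rightarrow> 'a list set \<Rightarrow> 'a list set set monoid" where
  "A_minus \<Sigma> L = quot_bsm (free_bsm (lists \<Sigma>)) (rel_minus \<Sigma> L)"

definition A_plus :: "'a set \<Rightarrow> 'a list set \<Rightarrow> 'a list set set monoid" where
  "A_plus \<Sigma> L = quot_bsm (free_bsm (lists \<Sigma>)) (rel_plus \<Sigma> L)"

lemma bsm_congruence_rel_minus: "bsm_congruence (free_bsm (lists \<Sigma>)) (rel_minus \<Sigma> L)"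
  unfolding bsm_congruence_def
proof
  show "equiv (carrier (free_bsm (lists \<Sigma>))) (rel_minus \<Sigma> L)"
  proof (rule equivI)
    show "rel_minus \<Sigma> L \<subseteq> carrier (free_bsm (lists \<Sigma>)) \<times> carrier (free_bsm (lists \<Sigma>))"
      by (auto simp: rel_minus_def)
  qed (simp_all add: rel_minus_def refl_on_def sym_def trans_def)
  show "\<forall>(a, a')\<in>rel_minus \<Sigma> L. \<forall>(b, b')\<in>rel_minus \<Sigma> L.
      (a \<otimes>\<^bsub>free_bsm (lists \<Sigma>)\<^esub> b, a' \<otimes>\<^bsub>free_bsm (lists \<Sigma>)\<^esub> b') \<in> rel_minus \<Sigma> L"
    by (clarsimp simp add: rel_minus_def free_bsm_def sum_boolean_Un)
qed

lemma bsm_congruence_rel_plus: "bsm_congruence (free_bsm (lists \<Sigma>)) (rel_plus \<Sigma> L)"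
  unfolding bsm_congruence_def
proof
  show "equiv (carrier (free_bsm (lists \<Sigma>))) (rel_plus \<Sigma> L)"
  proof (rule equivI)
    show "rel_plus \<Sigma> L \<subseteq> carrier (free_bsm (lists \<Sigma>)) \<times> carrier (free_bsm (lists \<Sigma>))"
      by (auto simp: rel_plus_def)
  qed (simp_all add: rel_plus_def refl_on_def sym_def trans_def)
  show "\<forall>(a, a')\<in>rel_plus \<Sigma> L. \<forall>(b, b')\<in>rel_plus \<Sigma> L.
      (a \<otimes>\<^bsub>free_bsm (lists \<Sigma>)\<^esub> b, a' \<otimes>\<^bsub>free_bsm (lists \<Sigma>)\<^esub> b') \<in> rel_plus \<Sigma> L"
    by (clarsimp simp add: rel_plus_def free_bsm_def sum_boolean_Un)
qed

lemma bsemimodule_A_minus: "bsemimodule (A_minus \<Sigma> L)"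
  unfolding A_minus_def
  by (intro bsemimodule_quot_bsm bsemimodule_free_bsm bsm_congruence_rel_minus)

lemma bsemimodule_A_plus: "bsemimodule (A_plus \<Sigma> L)"
  unfolding A_plus_def
  by (intro bsemimodule_quot_bsm bsemimodule_free_bsm bsm_congruence_rel_plus)

text \<open>The semilinear extensions of \<open>\<alpha>\<^sub>L(x u)\<close> to \<open>u \<in> A(+)\<close> and of \<open>\<alpha>\<^sub>L(v y)\<close> to \<open>v \<in> A(-)\<close>: the common
  value on all representatives of the class.\<close>

definition alpha_plus :: "'a list set \<Rightarrow> 'a list \<Rightarrow> 'a list set set \<Rightarrow> boolean" where
  "alpha_plus L x u = the_elem ((\<lambda>S. \<Sum>\<omega>\<in>S. alpha L (x @ \<omega>)) ` u)"

definition alpha_minus :: "'a list set \<Rightarrow> 'a list set set \<Rightarrow> 'a list \<Rightarrow> boolean" where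
  "alpha_minus L v y = the_elem ((\<lambda>S. \<Sum>\<omega>\<in>S. alpha L (\<omega> @ y)) ` v)"

lemma alpha_plus_eq:
  assumes "x \<in> lists \<Sigma>" "u \<in> carrier (A_plus \<Sigma> L)" "S \<in> u"
  shows "alpha_plus L x u = (\<Sum>\<omega>\<in>S. alpha L (x @ \<omega>))"
proof -
  have "(\<Sum>\<omega>\<in>T. alpha L (x @ \<omega>)) = (\<Sum>\<omega>\<in>S. alpha L (x @ \<omega>))" if "T \<in> u" for T
  proof -
    obtain S0 where S0: "u = rel_plus \<Sigma> L `` {S0}"
      using assms(2) by (auto simp: A_plus_def quot_bsm_def elim: quotientE)
    have "(\<Sum>\<omega>\<in>R. alpha L (x @ \<omega>)) = (\<Sum>\<omega>\<in>S0. alpha L (x @ \<omega>))" if "R \<in> u" for R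
    proof -
      have "(S0, R) \<in> rel_plus \<Sigma> L" using that unfolding S0 by blast
      then show ?thesis using assms(1) by (simp add: rel_plus_def)
    qed
    from this[OF that] this[OF assms(3)] show ?thesis
      by (rule HOL.trans[OF _ HOL.sym])
  qed
  then have "(\<lambda>S. \<Sum>\<omega>\<in>S. alpha L (x @ \<omega>)) ` u = {\<Sum>\<omega>\<in>S. alpha L (x @ \<omega>)}"
    using assms(3) by blast
  then show ?thesis by (simp add: alpha_plus_def)
qed

lemma alpha_minus_eq:
  assumes "y \<in> lists \<Sigma>" "v \<in> carrier (A_minus \<Sigma> L)" "S \<in> v"
  shows "alpha_minus L v y = (\<Sum>\<omega>\<in>S. alpha L (\<omega> @ y))"
proof -
  have "(\<Sum>\<omega>\<in>T. alpha L (\<omega> @ y)) = (\<Sum>\<omega>\<in>S. alpha L (\<omega> @ y))" if "T \<in> v" for T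
  proof -
    obtain S0 where S0: "v = rel_minus \<Sigma> L `` {S0}"
      using assms(2) by (auto simp: A_minus_def quot_bsm_def elim: quotientE)
    have "(\<Sum>\<omega>\<in>R. alpha L (\<omega> @ y)) = (\<Sum>\<omega>\<in>S0. alpha L (\<omega> @ y))" if "R \<in> v" for R
    proof -
      have "(S0, R) \<in> rel_minus \<Sigma> L" using that unfolding S0 by blast
      then show ?thesis using assms(1) by (simp add: rel_minus_def)
    qed
    from this[OF that] this[OF assms(3)] show ?thesis
      by (rule HOL.trans[OF _ HOL.sym])
  qed
  then have "(\<lambda>S. \<Sum>\<omega>\<in>S. alpha L (\<omega> @ y)) ` v = {\<Sum>\<omega>\<in>S. alpha L (\<omega> @ y)}"
    using assms(3) by blast
  then show ?thesis by (simp add: alpha_minus_def)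
qed

definition decomposition_of_identity ::
  "'a set \<Rightarrow> 'a list set \<Rightarrow> ('a list set set \<times> 'a list set set) set set \<Rightarrow> bool" where
  "decomposition_of_identity \<Sigma> L t \<longleftrightarrow>
    t \<in> carrier (tensor (A_plus \<Sigma> L) (A_minus \<Sigma> L)) \<and>
    (\<exists>(m::nat) u v.
      u \<in> {1..m} \<rightarrow> carrier (A_plus \<Sigma> L) \<and> v \<in> {1..m} \<rightarrow> carrier (A_minus \<Sigma> L) \<and>
      t = finprod (tensor (A_plus \<Sigma> L) (A_minus \<Sigma> L))
            (\<lambda>i. pure_tensor (A_plus \<Sigma> L) (A_minus \<Sigma> L) (u i) (v i)) {1..m} \<and>
      (\<forall>x\<in>lists \<Sigma>. \<forall>y\<in>lists \<Sigma>.
        alpha L (x @ y) = (\<Sum>i=1..m. alpha_plus L x (u i) * alpha_minus L (v i) y)))"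

end

theory Submission
  imports Defs
begin

text \<open>A decomposition \<open>\<Sum> u\<^sub>i \<otimes> v\<^sub>i\<close> of the identity is a dual basis of \<open>A(-)\<close>: every state \<open>a\<close> is the sum of
  the \<open>v\<^sub>i\<close> with \<open>\<alpha>\<^sub>L(a u\<^sub>i) = 1\<close>, and homomorphisms out of a semimodule with a dual basis lift along
  surjections. Conversely, projectivity gives a section of \<open>\<bool>[\<Sigma>\<^sup>*] \<rightarrow> A(-)\<close>, whose coordinates are
  functionals \<open>\<phi>\<^sub>w\<close> on \<open>A(-)\<close>, finitely many of them nonzero because \<open>A(-)\<close> is finite. A functional
  \<open>\<phi>\<close> on a finite semimodule is determined by the largest element \<open>m\<close> of its kernel: it vanishes
  exactly below \<open>m\<close>. The functionals \<open>a \<mapsto> \<alpha>\<^sub>L(a y)\<close> separate points, so each \<open>a\<close> not below \<open>m\<close>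
  is detected by some word \<open>y\<close> with \<open>\<alpha>\<^sub>L(m y) = 0\<close>; the sum of the words chosen for all such \<open>a\<close> is
  an element of \<open>A(+)\<close> that represents \<open>\<phi>\<close>.\<close>

section \<open>Functionals on semimodules\<close>

text \<open>Homomorphisms to the Boolean semiring, as predicates.\<close>

definition functional :: "'a monoid \<Rightarrow> ('a \<Rightarrow> bool) \<Rightarrow> bool" where
  "functional M \<phi> \<longleftrightarrow> \<not> \<phi> \<one>\<^bsub>M\<^esub> \<and>
    (\<forall>a\<in>carrier M. \<forall>b\<in>carrier M. \<phi> (a \<otimes>\<^bsub>M\<^esub> b) \<longleftrightarrow> \<phi> a \<or> \<phi> b)"

text \<open>Pointwise disjunction is the sum of functionals. It makes the pairing with an element of
  \<open>A_plus\<close>, that is with a sum of words, a functional.\<close>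

lemma functional_Bex:
  assumes "\<And>i. i \<in> I \<Longrightarrow> functional M (\<phi> i)"
  shows "functional M (\<lambda>a. \<exists>i\<in>I. \<phi> i a)"
  using assms unfolding functional_def by blast

lemma functional_finprod:
  assumes "comm_monoid M" "functional M \<phi>" "finite S" "f \<in> S \<rightarrow> carrier M"
  shows "\<phi> (finprod M f S) \<longleftrightarrow> (\<exists>x\<in>S. \<phi> (f x))"
proof -
  interpret M: comm_monoid M by fact
  show ?thesis
    using assms(3,4)
  proof (induction S rule: finite_induct)
    case empty
    then show ?case using assms(2) by (simp add: functional_def)
  next
    case (insert x S)
    then have "f x \<in> carrier M" "f \<in> S \<rightarrow> carrier M" "finprod M f S \<in> carrier M"
      by auto
    then show ?case
      using insert assms(2) by (simp add: functional_def)
  qed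
qed

text \<open>On a finite semimodule, a separating family of functionals generates all functionals
  under finite sums. This is what turns abstract functionals on \<open>A_minus\<close> into elements
  of \<open>A_plus\<close>.\<close>

lemma functional_eq_finite_Bex:
  assumes "bsemimodule M" "finite (carrier M)" "functional M \<phi>"
    and E: "\<And>y. y \<in> Y \<Longrightarrow> functional M (E y)"
    and separating: "\<And>a b. \<lbrakk>a \<in> carrier M; b \<in> carrier M; \<forall>y\<in>Y. E y a = E y b\<rbrakk> \<Longrightarrow> a = b"
  obtains Y' where "finite Y'" "Y' \<subseteq> Y" "\<forall>a\<in>carrier M. \<phi> a \<longleftrightarrow> (\<exists>y\<in>Y'. E y a)"
proof -
  interpret M: bsemimodule M by fact
  let ?K = "{a \<in> carrier M. \<not> \<phi> a}"
  \<comment> \<open>The kernel is finite and closed under sums, so the sum of all its elements is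
    its largest element.\<close>
  define m where "m = finprod M (\<lambda>a. a) ?K"
  have K: "finite ?K" "(\<lambda>a. a) \<in> ?K \<rightarrow> carrier M" using assms(2) by auto
  have mc: "m \<in> carrier M" unfolding m_def using K by (intro M.finprod_closed)
  have "\<not> \<phi> m"
    unfolding m_def using functional_finprod[OF M.comm_monoid_axioms assms(3) K] by simp
  \<comment> \<open>Since \<open>m\<close> is the sum of the kernel, a functional vanishing at
    \<open>m\<close> vanishes on every summand. Hence the chosen \<open>y\<close> never detect an
    element of the kernel.\<close>
  have below: "\<not> E y b" if "y \<in> Y" "\<not> E y m" "b \<in> ?K" for y b
    using functional_finprod[OF M.comm_monoid_axioms E[OF that(1)] K] that
    unfolding m_def by blast
  have "\<exists>y\<in>Y. E y a \<and> \<not> E y m" if a: "a \<in> carrier M" "\<phi> a" for a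
  proof -
    have "\<phi> (a \<otimes>\<^bsub>M\<^esub> m)"
      using a mc assms(3) by (simp add: functional_def)
    \<comment> \<open>An \<open>E y\<close> that tells \<open>a + m\<close> from \<open>m\<close>
      must be false at \<open>m\<close> and true at \<open>a\<close>, by additivity.\<close>
    then have "a \<otimes>\<^bsub>M\<^esub> m \<noteq> m" using \<open>\<not> \<phi> m\<close> by metis
    then obtain y where y: "y \<in> Y" "E y (a \<otimes>\<^bsub>M\<^esub> m) \<noteq> E y m"
      using separating[of "a \<otimes>\<^bsub>M\<^esub> m" m] a mc by blast
    then show ?thesis
      using E[OF y(1)] a mc by (auto simp: functional_def)
  qed
  then obtain g where g: "\<And>a. \<lbrakk>a \<in> carrier M; \<phi> a\<rbrakk> \<Longrightarrow> g a \<in> Y \<and> E (g a) a \<and> \<not> E (g a) m"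
    by metis
  show thesis
  proof
    show "finite (g ` {a \<in> carrier M. \<phi> a})" using assms(2) by simp
    show "g ` {a \<in> carrier M. \<phi> a} \<subseteq> Y" using g by blast
    show "\<forall>a\<in>carrier M. \<phi> a \<longleftrightarrow> (\<exists>y\<in>g ` {a \<in> carrier M. \<phi> a}. E y a)"
      using g below by blast
  qed
qed


section \<open>Projectivity from a dual basis\<close>

lemma compose_bhom:
  assumes "bsemimodule P" "g \<in> bhom P M" "f \<in> bhom M N"
  shows "compose (carrier P) f g \<in> bhom P N"
proof -
  interpret P: bsemimodule P by fact
  show ?thesis
    using assms(2,3) by (auto simp: bhom_def hom_def compose_def Pi_def)
qed

text \<open>A homomorphism \<open>g\<close> is determined by the values \<open>g (v i)\<close>.
  Choosing preimages \<open>x i\<close> of them and sending \<open>a\<close> to the sum of the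
  \<open>x i\<close> with \<open>\<phi> i a\<close> lifts it, for element types \<open>'m\<close>
  and \<open>'n\<close> left arbitrary.\<close>

lemma projective_dual_basis:
  fixes P :: "'p monoid"
  assumes "bsemimodule P" "finite I" "v \<in> I \<rightarrow> carrier P"
    and \<phi>: "\<And>i. i \<in> I \<Longrightarrow> functional P (\<phi> i)"
    and basis: "\<And>a. a \<in> carrier P \<Longrightarrow> a = finprod P v {i \<in> I. \<phi> i a}"
  shows "projective TYPE('m) TYPE('n) P"
proof -
  interpret P: bsemimodule P by fact
  have "g \<in> (\<lambda>g. compose (carrier P) f g) ` bhom P M"
    if M: "bsemimodule M" and N: "bsemimodule N" and f: "f \<in> bhom M N" "f ` carrier M = carrier N"
      and g: "g \<in> bhom P N" for M :: "'m monoid" and N :: "'n monoid" and f g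
  proof -
    interpret M: bsemimodule M by fact
    interpret N: bsemimodule N by fact
    have "\<exists>x\<in>carrier M. f x = g (v i)" if "i \<in> I" for i
    proof -
      have "g (v i) \<in> f ` carrier M"
        using that g assms(3) unfolding f(2) by (auto simp: bhom_def hom_def Pi_def)
      then show ?thesis by (auto simp: image_iff)
    qed
    then obtain x where x: "\<And>i. i \<in> I \<Longrightarrow> x i \<in> carrier M \<and> f (x i) = g (v i)"
      by metis
    let ?I = "\<lambda>a. {i \<in> I. \<phi> i a}"
    define h where "h = restrict (\<lambda>a. finprod M x (?I a)) (carrier P)"
    have "h \<in> bhom P M"
    proof -
      have "h (a \<otimes>\<^bsub>P\<^esub> b) = h a \<otimes>\<^bsub>M\<^esub> h b" if "a \<in> carrier P" "b \<in> carrier P" for a b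
      proof -
        have "?I (a \<otimes>\<^bsub>P\<^esub> b) = ?I a \<union> ?I b"
          using \<phi> that by (auto simp: functional_def)
        \<comment> \<open>The two index sets may overlap; idempotence of \<open>M\<close> absorbs
          the repeated summands.\<close>
        moreover have "finprod M x (?I a \<union> ?I b) = finprod M x (?I a) \<otimes>\<^bsub>M\<^esub> finprod M x (?I b)"
          using x assms(2) by (intro M.finprod_Un_idem) auto
        ultimately show ?thesis using that by (simp add: h_def)
      qed
      moreover have "h a \<in> carrier M" if "a \<in> carrier P" for a
        using that x by (auto simp: h_def intro!: M.finprod_closed)
      moreover have "?I \<one>\<^bsub>P\<^esub> = {}"
        using \<phi> by (auto simp: functional_def)
      then have "h \<one>\<^bsub>P\<^esub> = \<one>\<^bsub>M\<^esub>"
        by (simp only: h_def restrict_apply' P.one_closed M.finprod_empty)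
      moreover have "h \<in> extensional (carrier P)" by (simp add: h_def)
      ultimately show ?thesis by (simp add: bhom_def hom_def)
    qed
    moreover have "compose (carrier P) f h = g"
    proof (rule extensionalityI)
      show "compose (carrier P) f h \<in> extensional (carrier P)" "g \<in> extensional (carrier P)"
        using g by (auto simp: bhom_def)
      fix a assume a: "a \<in> carrier P"
      have fin: "finite (?I a)" using assms(2) by simp
      have "compose (carrier P) f h a = f (finprod M x (?I a))"
        using a by (simp add: compose_def h_def)
      also have "\<dots> = finprod N (\<lambda>i. f (x i)) (?I a)"
        by (rule bhom_finprod[OF M N f(1) fin]) (use x in auto)
      also have "\<dots> = finprod N (\<lambda>i. g (v i)) (?I a)"
        using x g assms(3) by (intro N.finprod_cong') (auto simp: bhom_def hom_def)
      also have "\<dots> = g (finprod P v (?I a))"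
        by (rule bhom_finprod[OF assms(1) N g fin, symmetric]) (use assms(3) in auto)
      also have "\<dots> = g a" using basis[OF a] by simp
      finally show "compose (carrier P) f h a = g a" .
    qed
    ultimately show ?thesis by blast
  qed
  then have "(\<lambda>g. compose (carrier P) f g) ` bhom P M = bhom P N"
    if "bsemimodule M" "bsemimodule N" "f \<in> bhom M N" "f ` carrier M = carrier N"
    for M :: "'m monoid" and N :: "'n monoid" and f
    using that compose_bhom[OF assms(1) _ that(3)] by (intro equalityI subsetI) auto
  then show ?thesis
    unfolding projective_def using assms(1) by blast
qed


section \<open>The state spaces\<close>

lemma boolean_sum_eq_1_iff:
  fixes f :: "'a \<Rightarrow> boolean"
  assumes "finite S"
  shows "sum f S = 1 \<longleftrightarrow> (\<exists>x\<in>S. f x = 1)"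
  using assms
proof (induction S rule: finite_induct)
  case (insert x S)
  have "a + b = 1 \<longleftrightarrow> a = 1 \<or> b = 1" for a b :: boolean
    by (cases a; cases b) (simp_all add: one_boolean_def plus_boolean_def)
  then show ?case using insert by simp
qed (simp add: zero_boolean_def one_boolean_def)

lemma boolean_times_eq_1_iff: "(a::boolean) * b = 1 \<longleftrightarrow> a = 1 \<and> b = 1"
  by (simp add: one_boolean_def times_boolean_def)

lemma boolean_eq_iff: "(a::boolean) = b \<longleftrightarrow> (a = 1 \<longleftrightarrow> b = 1)"
  by (cases a; cases b) (simp_all add: one_boolean_def)

lemma boolean_sum_eq_iff:
  fixes f :: "'a \<Rightarrow> boolean" and g :: "'b \<Rightarrow> boolean"
  assumes "finite S" "finite T"
  shows "sum f S = sum g T \<longleftrightarrow> ((\<exists>x\<in>S. f x = 1) \<longleftrightarrow> (\<exists>x\<in>T. g x = 1))"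
  unfolding boolean_sum_eq_1_iff[OF assms(1), symmetric] boolean_sum_eq_1_iff[OF assms(2), symmetric]
  by (rule boolean_eq_iff)

lemma alpha_eq_1_iff [simp]: "alpha L \<omega> = 1 \<longleftrightarrow> \<omega> \<in> L"
  by (simp add: alpha_def)

lemma rel_minus_iff:
  "(S, T) \<in> rel_minus \<Sigma> L \<longleftrightarrow>
    S \<subseteq> lists \<Sigma> \<and> finite S \<and> T \<subseteq> lists \<Sigma> \<and> finite T \<and>
    (\<forall>u\<in>lists \<Sigma>. (\<exists>\<omega>\<in>S. \<omega> @ u \<in> L) \<longleftrightarrow> (\<exists>\<omega>\<in>T. \<omega> @ u \<in> L))"
  by (simp add: rel_minus_def free_bsm_def boolean_sum_eq_iff cong: conj_cong)

lemma rel_minus_equiv: "equiv (carrier (free_bsm (lists \<Sigma>))) (rel_minus \<Sigma> L)"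
  by (rule conjunct1[OF bsm_congruence_rel_minus[unfolded bsm_congruence_def]])

lemma rel_plus_equiv: "equiv (carrier (free_bsm (lists \<Sigma>))) (rel_plus \<Sigma> L)"
  by (rule conjunct1[OF bsm_congruence_rel_plus[unfolded bsm_congruence_def]])

lemma carrier_A_minus:
  "carrier (A_minus \<Sigma> L) = (\<lambda>S. rel_minus \<Sigma> L `` {S}) ` {S. S \<subseteq> lists \<Sigma> \<and> finite S}"
  by (auto simp: A_minus_def quot_bsm_def quotient_def free_bsm_def)

lemma carrier_A_plus:
  "carrier (A_plus \<Sigma> L) = (\<lambda>S. rel_plus \<Sigma> L `` {S}) ` {S. S \<subseteq> lists \<Sigma> \<and> finite S}"
  by (auto simp: A_plus_def quot_bsm_def quotient_def free_bsm_def)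

lemma A_minus_mult:
  assumes "S \<subseteq> lists \<Sigma>" "finite S" "T \<subseteq> lists \<Sigma>" "finite T"
  shows "rel_minus \<Sigma> L `` {S} \<otimes>\<^bsub>A_minus \<Sigma> L\<^esub> rel_minus \<Sigma> L `` {T} = rel_minus \<Sigma> L `` {S \<union> T}"
  using quot_bsm_mult[OF bsm_congruence_rel_minus, of S \<Sigma> T L] assms
  by (simp add: A_minus_def free_bsm_def)

lemma A_minus_one: "\<one>\<^bsub>A_minus \<Sigma> L\<^esub> = rel_minus \<Sigma> L `` {{}}"
  by (simp add: A_minus_def quot_bsm_def free_bsm_def)

lemma alpha_minus_class:
  assumes "y \<in> lists \<Sigma>" "S \<subseteq> lists \<Sigma>" "finite S"
  shows "alpha_minus L (rel_minus \<Sigma> L `` {S}) y = 1 \<longleftrightarrow> (\<exists>\<omega>\<in>S. \<omega> @ y \<in> L)"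
proof -
  have "S \<in> rel_minus \<Sigma> L `` {S}"
    using assms by (simp add: rel_minus_iff)
  then show ?thesis
    using alpha_minus_eq[OF assms(1), of "rel_minus \<Sigma> L `` {S}" L S] assms
    by (auto simp: carrier_A_minus boolean_sum_eq_1_iff)
qed

lemma alpha_plus_class:
  assumes "x \<in> lists \<Sigma>" "S \<subseteq> lists \<Sigma>" "finite S"
  shows "alpha_plus L x (rel_plus \<Sigma> L `` {S}) = 1 \<longleftrightarrow> (\<exists>\<omega>\<in>S. x @ \<omega> \<in> L)"
proof -
  have "S \<in> rel_plus \<Sigma> L `` {S}"
    by (rule equiv_class_self[OF rel_plus_equiv]) (use assms in \<open>simp add: free_bsm_def\<close>)
  then show ?thesis
    using alpha_plus_eq[OF assms(1), of "rel_plus \<Sigma> L `` {S}" L S] assms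
    by (auto simp: carrier_A_plus boolean_sum_eq_1_iff)
qed

lemma functional_alpha_minus:
  assumes "y \<in> lists \<Sigma>"
  shows "functional (A_minus \<Sigma> L) (\<lambda>a. alpha_minus L a y = 1)"
  using assms
  by (auto simp: functional_def A_minus_one carrier_A_minus A_minus_mult alpha_minus_class)

text \<open>The quotient identifies exactly those formal sums on which all evaluations at words
  agree.\<close>

lemma alpha_minus_separating:
  assumes "a \<in> carrier (A_minus \<Sigma> L)" "b \<in> carrier (A_minus \<Sigma> L)"
    and "\<forall>y\<in>lists \<Sigma>. (alpha_minus L a y = 1) = (alpha_minus L b y = 1)"
  shows "a = b"
proof -
  obtain S T where ST: "S \<subseteq> lists \<Sigma>" "finite S" "T \<subseteq> lists \<Sigma>" "finite T"
    "a = rel_minus \<Sigma> L `` {S}" "b = rel_minus \<Sigma> L `` {T}"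
    using assms(1,2) by (auto simp: carrier_A_minus)
  then have "(S, T) \<in> rel_minus \<Sigma> L"
    using assms(3) by (simp add: rel_minus_iff alpha_minus_class)
  then show ?thesis
    unfolding ST(5,6) by (rule equiv_class_eq[OF rel_minus_equiv])
qed

section \<open>Finiteness of the state space of a regular language\<close>

text \<open>The class of a finite set of words depends only on the set of automaton states these
  words reach from \<open>q0\<close>, and \<open>Q\<close> has finitely many subsets.\<close>

lemma finite_A_minus:
  assumes "regular_language \<Sigma> L"
  shows "finite (carrier (A_minus \<Sigma> L))"
proof -
  obtain Q :: "nat set" and q0 \<delta> F where Q: "finite Q" "q0 \<in> Q"
    and \<delta>: "\<forall>q\<in>Q. \<forall>a\<in>\<Sigma>. \<delta> q a \<in> Q" and L: "L = {\<omega> \<in> lists \<Sigma>. foldl \<delta> q0 \<omega> \<in> F}"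
    using assms unfolding regular_language_def by blast
  have reach: "foldl \<delta> q \<omega> \<in> Q" if "\<omega> \<in> lists \<Sigma>" "q \<in> Q" for \<omega> q
    using that by (induction \<omega> arbitrary: q) (auto simp: \<delta>)
  let ?X = "{S. S \<subseteq> lists \<Sigma> \<and> finite S}"
  let ?st = "\<lambda>S. foldl \<delta> q0 ` S"
  have acc: "(\<exists>\<omega>\<in>S. \<omega> @ u \<in> L) \<longleftrightarrow> (\<exists>q\<in>?st S. foldl \<delta> q u \<in> F)"
    if "S \<in> ?X" "u \<in> lists \<Sigma>" for S u
    using that by (auto simp: L)
  have eq: "rel_minus \<Sigma> L `` {S} = rel_minus \<Sigma> L `` {T}"
    if "S \<in> ?X" "T \<in> ?X" "?st S = ?st T" for S T
  proof -
    have "(S, T) \<in> rel_minus \<Sigma> L"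
      using that by (simp add: rel_minus_iff acc[OF that(1)] acc[OF that(2)] flip: that(3))
    then show ?thesis by (rule equiv_class_eq[OF rel_minus_equiv])
  qed
  \<comment> \<open>If no finite set of words reaches exactly \<open>R\<close>, then
    \<open>SOME\<close> yields an arbitrary value, which is harmless since only an inclusion is
    claimed.\<close>
  have "carrier (A_minus \<Sigma> L) \<subseteq>
      (\<lambda>R. rel_minus \<Sigma> L `` {SOME S. S \<in> ?X \<and> ?st S = R}) ` Pow Q"
  proof
    fix a assume "a \<in> carrier (A_minus \<Sigma> L)"
    then obtain S where S: "S \<in> ?X" "a = rel_minus \<Sigma> L `` {S}"
      by (auto simp: carrier_A_minus)
    let ?T = "SOME T. T \<in> ?X \<and> ?st T = ?st S"
    have "?T \<in> ?X \<and> ?st ?T = ?st S"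
      by (rule someI[of _ S]) (use S in simp)
    then have "a = rel_minus \<Sigma> L `` {?T}"
      unfolding S(2) by (intro eq) (use S(1) in simp_all)
    moreover have "?st S \<in> Pow Q"
      using S(1) reach[OF _ Q(2)] by blast
    ultimately show "a \<in> (\<lambda>R. rel_minus \<Sigma> L `` {SOME S. S \<in> ?X \<and> ?st S = R}) ` Pow Q"
      by blast
  qed
  then show ?thesis
    by (rule finite_subset) (use Q(1) in simp)
qed

section \<open>From a decomposition of the identity to projectivity\<close>

lemma decomposition_imp_projective:
  assumes "decomposition_of_identity \<Sigma> L t"
  shows "projective TYPE('m) TYPE('n) (A_minus \<Sigma> L)"
proof -
  let ?A = "A_minus \<Sigma> L"
  interpret A: bsemimodule ?A by (rule bsemimodule_A_minus)
  obtain m :: nat and u v where u: "u \<in> {1..m} \<rightarrow> carrier (A_plus \<Sigma> L)"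
    and v: "v \<in> {1..m} \<rightarrow> carrier ?A"
    and dec: "\<And>x y. \<lbrakk>x \<in> lists \<Sigma>; y \<in> lists \<Sigma>\<rbrakk> \<Longrightarrow>
        alpha L (x @ y) = (\<Sum>i=1..m. alpha_plus L x (u i) * alpha_minus L (v i) y)"
    using assms unfolding decomposition_of_identity_def by blast
  have "\<exists>S. S \<subseteq> lists \<Sigma> \<and> finite S \<and> u i = rel_plus \<Sigma> L `` {S}" if "i \<in> {1..m}" for i
  proof -
    have "u i \<in> carrier (A_plus \<Sigma> L)" using u that by blast
    then show ?thesis by (auto simp: carrier_A_plus)
  qed
  then obtain U where U: "\<And>i. i \<in> {1..m} \<Longrightarrow> U i \<subseteq> lists \<Sigma>" "\<And>i. i \<in> {1..m} \<Longrightarrow> finite (U i)"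
    "\<And>i. i \<in> {1..m} \<Longrightarrow> u i = rel_plus \<Sigma> L `` {U i}"
    by metis
  have dec': "x @ y \<in> L \<longleftrightarrow>
      (\<exists>i\<in>{1..m}. (\<exists>w\<in>U i. x @ w \<in> L) \<and> alpha_minus L (v i) y = 1)"
    if "x \<in> lists \<Sigma>" "y \<in> lists \<Sigma>" for x y
  proof -
    have "x @ y \<in> L \<longleftrightarrow> (\<exists>i\<in>{1..m}. alpha_plus L x (u i) = 1 \<and> alpha_minus L (v i) y = 1)"
      unfolding alpha_eq_1_iff[symmetric] dec[OF that]
      by (simp only: boolean_sum_eq_1_iff finite_atLeastAtMost boolean_times_eq_1_iff)
    then show ?thesis
      using alpha_plus_class[OF that(1)] U by simp
  qed
  \<comment> \<open>This is the functional \<open>\<alpha>\<^sub>L(a u\<^sub>i)\<close>, with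
    \<open>u\<^sub>i\<close> expanded into its representing words \<open>U i\<close>.\<close>
  define \<phi> where "\<phi> = (\<lambda>i a. \<exists>w\<in>U i. alpha_minus L a w = 1)"
  show ?thesis
  proof (rule projective_dual_basis[OF bsemimodule_A_minus _ v])
    show "functional ?A (\<phi> i)" if "i \<in> {1..m}" for i
      unfolding \<phi>_def using U(1)[OF that]
      by (intro functional_Bex functional_alpha_minus) blast
    fix a assume a: "a \<in> carrier ?A"
    then obtain S where S: "S \<subseteq> lists \<Sigma>" "finite S" "a = rel_minus \<Sigma> L `` {S}"
      by (auto simp: carrier_A_minus)
    have \<phi>: "\<phi> i a \<longleftrightarrow> (\<exists>w\<in>U i. \<exists>\<omega>\<in>S. \<omega> @ w \<in> L)" if "i \<in> {1..m}" for i
    proof -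
      have "alpha_minus L a w = 1 \<longleftrightarrow> (\<exists>\<omega>\<in>S. \<omega> @ w \<in> L)" if "w \<in> U i" for w
        unfolding S(3) by (rule alpha_minus_class[OF _ S(1,2)])
          (use that U(1)[OF \<open>i \<in> {1..m}\<close>] in blast)
      then show ?thesis unfolding \<phi>_def by blast
    qed
    let ?I = "{i \<in> {1..m}. \<phi> i a}"
    have I: "finite ?I" "v \<in> ?I \<rightarrow> carrier ?A" using v by auto
    show "a = finprod ?A v ?I"
    proof (rule alpha_minus_separating[OF a])
      show "finprod ?A v ?I \<in> carrier ?A" using I by (intro A.finprod_closed)
      show "\<forall>y\<in>lists \<Sigma>. (alpha_minus L a y = 1) = (alpha_minus L (finprod ?A v ?I) y = 1)"
      proof
        fix y assume y: "y \<in> lists \<Sigma>"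
        have "alpha_minus L a y = 1 \<longleftrightarrow> (\<exists>\<omega>\<in>S. \<omega> @ y \<in> L)"
          unfolding S(3) by (rule alpha_minus_class[OF y S(1,2)])
        \<comment> \<open>Extend the decomposition linearly in its first argument: apply it with
          \<open>x\<close> running over the words of \<open>S\<close> and collect, for each
          \<open>i\<close>, the words that pair to 1 with \<open>u i\<close>.\<close>
        also have "\<dots> \<longleftrightarrow> (\<exists>i\<in>{1..m}. \<phi> i a \<and> alpha_minus L (v i) y = 1)"
          using dec'[OF _ y] \<phi> S(1) by blast
        also have "\<dots> \<longleftrightarrow> alpha_minus L (finprod ?A v ?I) y = 1"
          using functional_finprod[OF A.comm_monoid_axioms functional_alpha_minus[OF y] I] by blast
        finally show "(alpha_minus L a y = 1) = (alpha_minus L (finprod ?A v ?I) y = 1)" .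
      qed
    qed
  qed simp
qed

section \<open>From projectivity to a decomposition of the identity\<close>

text \<open>Projectivity lifts the identity of \<open>A_minus\<close> along the quotient map from
  the free semimodule. The two types in the hypothesis are the element types of the free semimodule
  and of \<open>A_minus\<close>.\<close>

lemma A_minus_section:
  fixes \<Sigma> :: "'a set"
  assumes "projective TYPE('a list set) TYPE('a list set set) (A_minus \<Sigma> L)"
  obtains s where "s \<in> bhom (A_minus \<Sigma> L) (free_bsm (lists \<Sigma>))"
    "\<And>a. a \<in> carrier (A_minus \<Sigma> L) \<Longrightarrow> rel_minus \<Sigma> L `` {s a} = a"
proof -
  let ?A = "A_minus \<Sigma> L" and ?F = "free_bsm (lists \<Sigma>)"
  interpret A: bsemimodule ?A by (rule bsemimodule_A_minus)
  define f where "f = restrict (\<lambda>S. rel_minus \<Sigma> L `` {S}) (carrier ?F)"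
  have cF: "carrier ?F = {S. S \<subseteq> lists \<Sigma> \<and> finite S}" "\<one>\<^bsub>?F\<^esub> = {}"
    "\<And>S T. S \<otimes>\<^bsub>?F\<^esub> T = S \<union> T"
    by (auto simp: free_bsm_def)
  have "f \<in> bhom ?F ?A"
    by (auto simp: f_def bhom_def hom_def cF carrier_A_minus A_minus_mult A_minus_one)
  moreover have "f ` carrier ?F = carrier ?A"
    by (auto simp: f_def cF carrier_A_minus)
  ultimately have "bhom ?A ?A = (\<lambda>g. compose (carrier ?A) f g) ` bhom ?A ?F"
    using assms bsemimodule_free_bsm unfolding projective_def by blast
  moreover have "restrict (\<lambda>a. a) (carrier ?A) \<in> bhom ?A ?A"
    by (auto simp: bhom_def hom_def)
  ultimately obtain s where s: "s \<in> bhom ?A ?F" "restrict (\<lambda>a. a) (carrier ?A) = compose (carrier ?A) f s"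
    by blast
  show thesis
  proof (rule that[OF s(1)])
    fix a assume a: "a \<in> carrier ?A"
    then have "s a \<in> carrier ?F" using s(1) by (auto simp: bhom_def hom_def)
    then show "rel_minus \<Sigma> L `` {s a} = a"
      using fun_cong[OF s(2), of a] a by (simp add: compose_def f_def)
  qed
qed

text \<open>With a section \<open>s\<close>, each state \<open>a\<close> is the sum of the classes
  of the words in \<open>s a\<close>. Representing the condition \<open>w \<in> s a\<close> by a
  finite set \<open>Y w\<close> of words gives the decomposition with terms
  \<open>[Y w] \<otimes> [w]\<close>.\<close>

lemma projective_imp_decomposition:
  fixes \<Sigma> :: "'a set"
  assumes "regular_language \<Sigma> L"
    and "projective TYPE('a list set) TYPE('a list set set) (A_minus \<Sigma> L)"
  shows "\<exists>t. decomposition_of_identity \<Sigma> L t"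
proof -
  let ?A = "A_minus \<Sigma> L" and ?B = "A_plus \<Sigma> L"
  interpret T: bsemimodule "tensor ?B ?A"
    by (intro bsemimodule_tensor bsemimodule_A_minus bsemimodule_A_plus)
  note fin = finite_A_minus[OF assms(1)]
  obtain s where s: "s \<in> bhom ?A (free_bsm (lists \<Sigma>))"
    and sec: "\<And>a. a \<in> carrier ?A \<Longrightarrow> rel_minus \<Sigma> L `` {s a} = a"
    using A_minus_section[OF assms(2)] by blast
  have sc: "s a \<subseteq> lists \<Sigma>" "finite (s a)" if "a \<in> carrier ?A" for a
    using s that by (auto simp: bhom_def hom_def free_bsm_def)
  \<comment> \<open>Addition in the free semimodule is union, so membership of \<open>w\<close> is
    the coordinate at \<open>w\<close>.\<close>
  have coord: "functional ?A (\<lambda>a. w \<in> s a)" for w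
    using s by (auto simp: functional_def bhom_def hom_def free_bsm_def)
  have "\<exists>Y. finite Y \<and> Y \<subseteq> lists \<Sigma> \<and>
      (\<forall>a\<in>carrier ?A. w \<in> s a \<longleftrightarrow> (\<exists>y\<in>Y. alpha_minus L a y = 1))" for w
    by (rule functional_eq_finite_Bex[OF bsemimodule_A_minus fin coord functional_alpha_minus])
      (use alpha_minus_separating in blast)+
  then obtain Y where Y: "\<And>w. finite (Y w)" "\<And>w. Y w \<subseteq> lists \<Sigma>"
    "\<And>w a. a \<in> carrier ?A \<Longrightarrow> w \<in> s a \<longleftrightarrow> (\<exists>y\<in>Y w. alpha_minus L a y = 1)"
    by metis
  \<comment> \<open>The words with a nonzero coordinate functional. Finiteness of
    \<open>A_minus\<close> makes this union finite, so that it can be indexed by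
    \<open>{1..card W}\<close>.\<close>
  define W where "W = (\<Union>a\<in>carrier ?A. s a)"
  have W: "finite W" "W \<subseteq> lists \<Sigma>" using sc fin by (auto simp: W_def)
  obtain e where e: "bij_betw e {1..card W} W"
    using ex_bij_betw_nat_finite_1[OF W(1)] by blast
  have bex_W: "(\<exists>w\<in>W. P w) \<longleftrightarrow> (\<exists>i\<in>{1..card W}. P (e i))" for P
  proof -
    have "(\<exists>w\<in>e ` {1..card W}. P w) \<longleftrightarrow> (\<exists>i\<in>{1..card W}. P (e i))" by blast
    then show ?thesis by (simp only: bij_betw_imp_surj_on[OF e])
  qed
  have eW: "e i \<in> lists \<Sigma>" if "i \<in> {1..card W}" for i
    using that bij_betwE[OF e] W(2) by blast
  define u where "u = (\<lambda>i. rel_plus \<Sigma> L `` {Y (e i)})"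
  define v where "v = (\<lambda>i. rel_minus \<Sigma> L `` {{e i}})"
  have u: "u \<in> {1..card W} \<rightarrow> carrier ?B"
    using Y by (auto simp: u_def carrier_A_plus)
  have v: "v \<in> {1..card W} \<rightarrow> carrier ?A"
    using eW by (auto simp: v_def carrier_A_minus)
  have dec: "alpha L (x @ y) = (\<Sum>i=1..card W. alpha_plus L x (u i) * alpha_minus L (v i) y)"
    if x: "x \<in> lists \<Sigma>" and y: "y \<in> lists \<Sigma>" for x y
  proof -
    let ?a = "rel_minus \<Sigma> L `` {{x}}"
    have a: "?a \<in> carrier ?A" using x by (auto simp: carrier_A_minus)
    have xS: "{x} \<subseteq> lists \<Sigma>" "finite {x}" using x by auto
    \<comment> \<open>Pairing the word \<open>x\<close> with the class of \<open>Y (e i)\<close> in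
      \<open>A_plus\<close> and evaluating the state of \<open>x\<close> at the words of
      \<open>Y (e i)\<close> both ask whether \<open>x @ z \<in> L\<close> for some \<open>z\<close>
      in \<open>Y (e i)\<close>.\<close>
    have ux: "alpha_plus L x (u i) = 1 \<longleftrightarrow> e i \<in> s ?a" for i
    proof -
      have "e i \<in> s ?a \<longleftrightarrow> (\<exists>z\<in>Y (e i). x @ z \<in> L)"
        unfolding Y(3)[OF a] using alpha_minus_class[OF _ xS] Y(2) by blast
      then show ?thesis
        using alpha_plus_class[OF x Y(2,1)] by (simp add: u_def)
    qed
    have vy: "alpha_minus L (v i) y = 1 \<longleftrightarrow> e i @ y \<in> L" if "i \<in> {1..card W}" for i
      using alpha_minus_class[OF y, of "{e i}"] eW[OF that] by (simp add: v_def)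
    have "x @ y \<in> L \<longleftrightarrow> alpha_minus L ?a y = 1"
      using alpha_minus_class[OF y xS] by simp
    \<comment> \<open>The word \<open>x\<close> is replaced by \<open>s ?a\<close>, another
      representative of the same class.\<close>
    also have "\<dots> \<longleftrightarrow> (\<exists>w\<in>s ?a. w @ y \<in> L)"
      using alpha_minus_class[OF y sc[OF a], of L] by (simp only: sec[OF a])
    also have "\<dots> \<longleftrightarrow> (\<exists>w\<in>W. w \<in> s ?a \<and> w @ y \<in> L)"
      using a by (auto simp: W_def)
    also have "\<dots> \<longleftrightarrow> (\<exists>i\<in>{1..card W}. e i \<in> s ?a \<and> e i @ y \<in> L)"
      by (rule bex_W)
    also have "\<dots> \<longleftrightarrow> (\<exists>i\<in>{1..card W}. alpha_plus L x (u i) * alpha_minus L (v i) y = 1)"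
      using ux vy by (simp add: boolean_times_eq_1_iff)
    finally show ?thesis
      by (subst boolean_eq_iff) (simp only: alpha_eq_1_iff boolean_sum_eq_1_iff finite_atLeastAtMost)
  qed
  have pure: "(\<lambda>i. pure_tensor ?B ?A (u i) (v i)) \<in> {1..card W} \<rightarrow> carrier (tensor ?B ?A)"
    using bilinear_map_pure_tensor[OF bsemimodule_A_plus bsemimodule_A_minus, of \<Sigma> L \<Sigma> L] u v
    by (fastforce simp: bilinear_map_def bhom_def hom_def Pi_def)
  have "decomposition_of_identity \<Sigma> L
      (finprod (tensor ?B ?A) (\<lambda>i. pure_tensor ?B ?A (u i) (v i)) {1..card W})"
    unfolding decomposition_of_identity_def using T.finprod_closed[OF pure] u v dec by blast
  then show ?thesis by blast
qed

text \<open>A formula cannot quantify over types. The equivalence is therefore stated at the pair of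
  types where the quotient map from the free semimodule lives, and a second conjunct gives
  projectivity at arbitrary \<open>'m\<close> and \<open>'n\<close>; together they express
  projectivity over all types.\<close>

theorem proposition4p11:
  fixes \<Sigma> :: "'a set" and L :: "'a list set"
  assumes "finite \<Sigma>" and "L \<subseteq> lists \<Sigma>" and "regular_language \<Sigma> L"
  shows "((\<exists>t. decomposition_of_identity \<Sigma> L t) \<longleftrightarrow>
            projective TYPE('a list set) TYPE('a list set set) (A_minus \<Sigma> L)) \<and>
         ((\<exists>t. decomposition_of_identity \<Sigma> L t) \<longrightarrow>
            projective TYPE('m) TYPE('n) (A_minus \<Sigma> L))"
proof (intro conjI iffI impI)
  assume "\<exists>t. decomposition_of_identity \<Sigma> L t"
  then obtain t where t: "decomposition_of_identity \<Sigma> L t" ..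
  show "projective TYPE('a list set) TYPE('a list set set) (A_minus \<Sigma> L)"
    "projective TYPE('m) TYPE('n) (A_minus \<Sigma> L)"
    by (rule decomposition_imp_projective[OF t])+
next
  assume "projective TYPE('a list set) TYPE('a list set set) (A_minus \<Sigma> L)"
  then show "\<exists>t. decomposition_of_identity \<Sigma> L t"
    by (rule projective_imp_decomposition[OF assms(3)])
qed

end
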